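(* Let $A$ be a unital complex Banach algebra. Let $a_0,a_1\in E_p(A)$, with $a_0$ fixed and $\|a_1-a_0\|$ sufficiently small. Then there exists a polygonal path in $E_p(A)$, connecting $a_0$ and $a_1$, consisting of $n$ segments, and the distance of this path from $a_0$ tends to $0$ as $\|a_1-a_0\|\to0$; that is, for every $a_0\in E_p(A)$ and $\varepsilon>0$ there is $\delta>0$ such that every $a_1\in E_p(A)$ with $\|a_1-a_0\|<\delta$ can be joined to $a_0$ by a polygonal path consisting of $n$ segments all of whose points lie in $E_p(A)$ and at distance less than $\varepsilon$ from $a_0$. Hence the connected component of $a_0$ in $E_p(A)$ is locally pathwise connected via polygonal paths of $n$ segments.
   Context: All Banach algebras have a unit of norm $1$. Fix an integer $n\ge2$, distinct $\lambda_1,\dots,\lambda_n\in\mathbb C$, and let $p(\lambda)=\prod_{i=1}^n(\lambda-\lambda_i)$. For a unital complex Banach algebra $A$, $E_p(A)=\{a\in A\mid p(a)=0\}$, with the norm topology of $A$. A polygonal path consisting of $n$ segments is a concatenation of $n$ (possibly degenerate) line segments $[x_0,x_1],[x_1,x_2],\dots,[x_{n-1},x_n]$ in $A$. Here $n$ is the degree of $p$. *)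

theory Defs
  imports "HOL-Analysis.Analysis" "HOL-Computational_Algebra.Polynomial"
begin

(* The superclass real_normed_algebra_1 contributes norm 1 = 1 and submultiplicativity of the
   norm; scaleC extends the real scalar multiplication to complex scalars. *)
class complex_banach_algebra_1 = real_normed_algebra_1 + banach +
  fixes scaleC :: "complex \<Rightarrow> 'a \<Rightarrow> 'a"  (infixr "*\<^sub>C" 75)
  assumes scaleC_of_real: "scaleC (complex_of_real r) x = scaleR r x"
    and scaleC_add_right: "scaleC c (x + y) = scaleC c x + scaleC c y"
    and scaleC_add_left: "scaleC (c + d) x = scaleC c x + scaleC d x"
    and scaleC_scaleC: "scaleC c (scaleC d x) = scaleC (c * d) x"
    and mult_scaleC_left: "scaleC c x * y = scaleC c (x * y)"
    and mult_scaleC_right: "x * scaleC c y = scaleC c (x * y)"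
    and norm_scaleC: "norm (scaleC c x) = cmod c * norm x"

instantiation complex :: complex_banach_algebra_1
begin

definition scaleC_complex :: "complex \<Rightarrow> complex \<Rightarrow> complex" where
  "scaleC_complex c x = c * x"

instance
  by standard (auto simp: scaleC_complex_def scaleR_conv_of_real algebra_simps norm_mult)

end

definition eval_poly :: "complex poly \<Rightarrow> 'a::complex_banach_algebra_1 \<Rightarrow> 'a" where
  "eval_poly p a = (\<Sum>i\<le>degree p. coeff p i *\<^sub>C a ^ i)"

definition zero_set :: "complex poly \<Rightarrow> 'a::complex_banach_algebra_1 set" where
  "zero_set p = {a. eval_poly p a = 0}"

definition polygonally_joined :: "nat \<Rightarrow> 'a::real_normed_vector set \<Rightarrow> 'a \<Rightarrow> 'a \<Rightarrow> bool" where
  "polygonally_joined n S a b \<longleftrightarrow>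
     (\<exists>x :: nat \<Rightarrow> 'a. x 0 = a \<and> x n = b \<and> (\<forall>i<n. closed_segment (x i) (x (Suc i)) \<subseteq> S))"

(* As in the usual neighbourhood form of local path connectedness, the paths joining two points
   of the small neighbourhood V are only required to stay in the given neighbourhood U:
   the number n of segments is fixed, so V cannot simply be enlarged to contain them. *)
definition locally_polygonally_connected :: "nat \<Rightarrow> 'a::real_normed_vector set \<Rightarrow> bool" where
  "locally_polygonally_connected n S \<longleftrightarrow>
     (\<forall>U x. openin (top_of_set S) U \<and> x \<in> U \<longrightarrow>
        (\<exists>V. openin (top_of_set S) V \<and> x \<in> V \<and> V \<subseteq> U \<and>
             (\<forall>y\<in>V. \<forall>z\<in>V. polygonally_joined n U y z)))"

end

theory Submission
  imports Defs
begin

text \<open>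
  A zero \<open>y\<close> of \<open>p\<close> is a diagonal element: it is determined by its spectral idempotents, hence by the
  increasing chain \<open>P k\<close> of their partial sums, \<open>P k\<close> being the idempotent of the eigenvalues
  \<open>l 1, ..., l k\<close>. The point of the proof is that many non-diagonal-looking elements are zeros too.
  If \<open>t\<close> is block upper triangular for the flag of ranges of the \<open>P k\<close>, with the scalars
  \<open>l 1, ..., l n\<close> on the diagonal, then \<open>t - l k\<close> maps the \<open>k\<close>-th space of the flag into the previous
  one, so the product of these factors vanishes and \<open>p(t) = 0\<close>. The triangularity condition is affine
  in \<open>t\<close>: two zeros of \<open>p\<close> that are triangular in this way for the same flag are joined by a line
  segment of zeros. The same holds for the flag of kernels.

  Let \<open>y\<close> and \<open>z\<close> be zeros near \<open>x\<close>, with chains \<open>P\<close> and \<open>Q\<close>. As \<open>P k\<close> and \<open>Q k\<close> are close, there is an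
  idempotent \<open>G k\<close> with the range of \<open>P k\<close> and the kernel of \<open>Q k\<close>, and these again form a chain. The
  zero \<open>b\<close> of \<open>p\<close> with chain \<open>G\<close> shares the range flag with \<open>y\<close> and the kernel flag with \<open>z\<close>, so the
  path from \<open>y\<close> through \<open>b\<close> to \<open>z\<close> stays in the zero set. In matrix terms this is a triangular
  factorisation of an element conjugating \<open>y\<close> into \<open>z\<close>. Two segments therefore suffice for every
  degree, and the remaining ones are degenerate. Since \<open>G\<close> depends continuously on the pair
  \<open>(y, z)\<close> and \<open>b = x\<close> for \<open>y = z = x\<close>, the path stays near \<open>x\<close>
  (\<open>nearby_zeros_polygonally_joined\<close>).

  Moving both end points, rather than only one, is what gives the local statement: a path that starts in
  a connected component never leaves it, so small relative neighbourhoods in the component are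
  joined within it.
\<close>

section \<open>Evaluation of polynomials in a Banach algebra\<close>

lemma bounded_linear_scaleC: "bounded_linear (scaleC c :: 'a::complex_banach_algebra_1 \<Rightarrow> 'a)"
proof (rule bounded_linear_intro)
  show "norm (c *\<^sub>C x) \<le> norm x * cmod c" for x :: 'a
    by (simp add: norm_scaleC mult.commute)
  show "c *\<^sub>C (r *\<^sub>R x) = r *\<^sub>R (c *\<^sub>C x)" for r and x :: 'a
    by (simp add: scaleC_of_real [symmetric] scaleC_scaleC mult.commute)
qed (rule scaleC_add_right)

lemmas scaleC_zero_right [simp] = linear_0 [OF bounded_linear.linear [OF bounded_linear_scaleC]]
  and scaleC_diff_right = linear_diff [OF bounded_linear.linear [OF bounded_linear_scaleC]]
  and tendsto_scaleC = bounded_linear.tendsto [OF bounded_linear_scaleC]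

lemma scaleC_zero_left [simp]: "0 *\<^sub>C (x :: 'a::complex_banach_algebra_1) = 0"
  using scaleC_of_real [of 0 x] by simp

lemma scaleC_one [simp]: "1 *\<^sub>C (x :: 'a::complex_banach_algebra_1) = x"
  using scaleC_of_real [of 1 x] by simp

lemma eval_poly_0 [simp]: "eval_poly 0 a = 0"
  by (simp add: eval_poly_def)

lemma eval_poly_pCons:
  "eval_poly (pCons c q) a = c *\<^sub>C 1 + a * eval_poly q a"
proof (cases "q = 0")
  case False
  then show ?thesis
    by (simp add: eval_poly_def sum.atMost_Suc_shift sum_distrib_left mult_scaleC_right
        del: sum.atMost_Suc)
qed (simp add: eval_poly_def)

lemma eval_poly_add: "eval_poly (q + r) a = eval_poly q a + eval_poly r a"
  by (induction q r rule: poly_induct2)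
    (simp_all add: eval_poly_pCons scaleC_add_left distrib_left add_ac)

lemma eval_poly_smult: "eval_poly (smult c q) a = c *\<^sub>C eval_poly q a"
  by (induction q)
    (simp_all add: eval_poly_pCons scaleC_add_right scaleC_scaleC mult_scaleC_right)

lemma eval_poly_mult: "eval_poly (q * r) a = eval_poly q a * eval_poly r a"
  by (induction q)
    (simp_all add: eval_poly_pCons eval_poly_add eval_poly_smult distrib_right
      mult_scaleC_left mult.assoc)

lemma eval_poly_1 [simp]: "eval_poly 1 a = 1"
  by (simp add: one_pCons eval_poly_pCons)

lemma eval_poly_linear: "eval_poly [:- c, 1:] a = a - c *\<^sub>C 1"
proof -
  have "(- c) *\<^sub>C (1 :: 'a) + c *\<^sub>C 1 = 0"
    by (simp flip: scaleC_add_left)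
  then show ?thesis
    by (simp add: eval_poly_pCons algebra_simps eq_neg_iff_add_eq_0)
qed

lemma eval_poly_sum: "eval_poly (\<Sum>i\<in>I. q i) a = (\<Sum>i\<in>I. eval_poly (q i) a)"
  by (induction I rule: infinite_finite_induct) (simp_all add: eval_poly_add)

lemma tendsto_eval_poly:
  assumes "(f \<longlongrightarrow> a) F"
  shows "((\<lambda>w. eval_poly q (f w)) \<longlongrightarrow> eval_poly q a) F"
  unfolding eval_poly_def
  by (intro tendsto_sum tendsto_scaleC tendsto_power assms)

section \<open>Polynomials prescribed at the nodes\<close>

lemma prod_linear_dvd:
  fixes l :: "'i \<Rightarrow> 'b::field"
  assumes "finite I" "inj_on l I" "\<And>i. i \<in> I \<Longrightarrow> poly q (l i) = 0"
  shows "(\<Prod>i\<in>I. [:- l i, 1:]) dvd q"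
  using assms
proof (induction I)
  case (insert j I)
  then obtain r where r: "q = (\<Prod>i\<in>I. [:- l i, 1:]) * r"
    by (auto elim!: dvdE)
  have "poly (\<Prod>i\<in>I. [:- l i, 1:]) (l j) \<noteq> 0"
    using insert.hyps insert.prems(1) by (auto simp: poly_prod)
  moreover have "poly q (l j) = 0"
    using insert.prems by simp
  ultimately have "[:- l j, 1:] dvd r"
    by (simp add: r poly_eq_0_iff_dvd)
  then show ?case
    using insert.hyps r by (simp add: mult.commute [of _ r] mult_dvd_mono del: mult_pCons_left)
qed simp

lemma lagrange_interpolation:
  fixes l f :: "'i \<Rightarrow> 'b::field"
  assumes "finite I" "inj_on l I"
  shows "\<exists>q. \<forall>i\<in>I. poly q (l i) = f i"
  using assms
proof (induction I)
  case (insert j I)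
  then obtain q where q: "\<forall>i\<in>I. poly q (l i) = f i"
    by auto
  define r where "r = (\<Prod>i\<in>I. [:- l i, 1:])"
  have r0: "poly r (l i) = 0" if "i \<in> I" for i
    using that insert.hyps by (auto simp: r_def poly_prod)
  have rj: "poly r (l j) \<noteq> 0"
    using insert.hyps insert.prems by (auto simp: r_def poly_prod)
  have "\<forall>i\<in>insert j I. poly (q + smult ((f j - poly q (l j)) / poly r (l j)) r) (l i) = f i"
    using q r0 rj by simp
  then show ?case ..
qed simp

text \<open>
  The roots being simple, a polynomial that vanishes at all of them is a multiple of \<open>p\<close>. Identities
  between polynomials in a zero of \<open>p\<close> can thus be checked pointwise at the nodes.
\<close>

lemma eval_poly_eqI:
  fixes l :: "nat \<Rightarrow> complex"
  assumes "inj_on l {1..n}" "a \<in> zero_set (\<Prod>i=1..n. [:- l i, 1:])"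
    and "\<And>i. i \<in> {1..n} \<Longrightarrow> poly q (l i) = poly r (l i)"
  shows "eval_poly q a = eval_poly r a"
proof -
  have "(\<Prod>i=1..n. [:- l i, 1:]) dvd q - r"
    using assms by (intro prod_linear_dvd) auto
  then obtain s where s: "q = (\<Prod>i=1..n. [:- l i, 1:]) * s + r"
    by (metis dvdE diff_eq_eq)
  show ?thesis
    using assms(2) by (simp add: s eval_poly_add eval_poly_mult zero_set_def)
qed

section \<open>Chains of idempotents and triangular elements\<close>

text \<open>
  For \<open>j \<le> k\<close> the two product conditions say that the range of \<open>P j\<close> lies in that of \<open>P k\<close> and that the
  kernel of \<open>P k\<close> lies in that of \<open>P j\<close>; for \<open>j = k\<close> they give idempotency.
\<close>

definition idempotent_chain :: "nat \<Rightarrow> (nat \<Rightarrow> 'a::ring_1) \<Rightarrow> bool" where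
  "idempotent_chain n P \<longleftrightarrow> P 0 = 0 \<and> P n = 1 \<and>
     (\<forall>j k. j \<le> k \<and> k \<le> n \<longrightarrow> P j * P k = P j \<and> P k * P j = P j)"

text \<open>
  For \<open>m = n\<close> this is the element with spectral idempotents \<open>P i - P (i - 1)\<close> and eigenvalues \<open>l i\<close>; the
  partial sums are its compressions to the range of \<open>P m\<close>.
\<close>

definition chain_sum :: "(nat \<Rightarrow> complex) \<Rightarrow> (nat \<Rightarrow> 'a::complex_banach_algebra_1) \<Rightarrow> nat \<Rightarrow> 'a"
  where "chain_sum l P m = (\<Sum>i<m. l (Suc i) *\<^sub>C (P (Suc i) - P i))"

text \<open>
  The condition says that \<open>t - l (k + 1)\<close> maps the range of \<open>P (k + 1)\<close> into that of \<open>P k\<close>: block upper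
  triangular form with diagonal \<open>l 1, ..., l n\<close>.
\<close>

definition range_triangular ::
    "(nat \<Rightarrow> complex) \<Rightarrow> nat \<Rightarrow> (nat \<Rightarrow> 'a) \<Rightarrow> 'a::complex_banach_algebra_1 set" where
  "range_triangular l n P =
     {t. \<forall>k<n. (1 - P k) * (t - l (Suc k) *\<^sub>C 1) * P (Suc k) = 0}"

text \<open>
  The condition says that \<open>t - l (k + 1)\<close> maps the kernel of \<open>Q k\<close> into that of \<open>Q (k + 1)\<close>: block lower
  triangular form with the same diagonal.
\<close>

definition kernel_triangular ::
    "(nat \<Rightarrow> complex) \<Rightarrow> nat \<Rightarrow> (nat \<Rightarrow> 'a) \<Rightarrow> 'a::complex_banach_algebra_1 set" where
  "kernel_triangular l n Q =
     {t. \<forall>k<n. Q (Suc k) * (t - l (Suc k) *\<^sub>C 1) * (1 - Q k) = 0}"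

lemma convex_sandwich_zero: "convex {t :: 'a::real_normed_algebra_1. x * (t - c) * y = 0}"
proof (rule convexI, safe)
  fix s t :: 'a and u v :: real
  assume st: "x * (s - c) * y = 0" "x * (t - c) * y = 0" and uv: "u + v = 1"
  have "u *\<^sub>R s + v *\<^sub>R t - c = u *\<^sub>R (s - c) + v *\<^sub>R (t - c)"
    using uv by (simp add: algebra_simps flip: scaleR_left_distrib)
  then have "x * (u *\<^sub>R s + v *\<^sub>R t - c) * y = u *\<^sub>R (x * (s - c) * y) + v *\<^sub>R (x * (t - c) * y)"
    by (simp only: distrib_left distrib_right mult_scaleR_left mult_scaleR_right)
  then show "x * (u *\<^sub>R s + v *\<^sub>R t - c) * y = 0"
    using st by simp
qed

lemma convex_range_triangular: "convex (range_triangular l n P)"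
proof -
  have "range_triangular l n P =
      (\<Inter>k\<in>{..<n}. {t. (1 - P k) * (t - l (Suc k) *\<^sub>C 1) * P (Suc k) = 0})"
    by (auto simp: range_triangular_def)
  then show ?thesis
    by (simp only:) (intro convex_INT convex_sandwich_zero)
qed

lemma convex_kernel_triangular: "convex (kernel_triangular l n Q)"
proof -
  have "kernel_triangular l n Q =
      (\<Inter>k\<in>{..<n}. {t. Q (Suc k) * (t - l (Suc k) *\<^sub>C 1) * (1 - Q k) = 0})"
    by (auto simp: kernel_triangular_def)
  then show ?thesis
    by (simp only:) (intro convex_INT convex_sandwich_zero)
qed

text \<open>
  The factors of \<open>p(t)\<close>, applied from the last to the first, push the whole algebra down the flag of
  ranges one step at a time until only \<open>0\<close> is left.
\<close>

lemma range_triangular_subset_zero_set: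
  assumes P: "idempotent_chain n P"
  shows "range_triangular l n P \<subseteq> zero_set (\<Prod>i=1..n. [:- l i, 1:])"
proof
  fix t assume t: "t \<in> range_triangular l n P"
  have "eval_poly (\<Prod>i=1..k. [:- l i, 1:]) t * P k = 0" if "k \<le> n" for k
    using that
  proof (induction k)
    case 0
    then show ?case
      using P by (simp add: idempotent_chain_def)
  next
    case (Suc k)
    let ?e = "eval_poly (\<Prod>i=1..k. [:- l i, 1:]) t" and ?d = "t - l (Suc k) *\<^sub>C 1"
    have "?d * P (Suc k) = P k * (?d * P (Suc k))"
      using t Suc.prems by (simp add: range_triangular_def left_diff_distrib mult.assoc)
    then have "?e * (?d * P (Suc k)) = ?e * (P k * (?d * P (Suc k)))"
      by (rule arg_cong)
    then have "?e * ?d * P (Suc k) = (?e * P k) * (?d * P (Suc k))"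
      by (simp only: mult.assoc)
    then show ?case
      using Suc by (simp add: eval_poly_mult eval_poly_linear del: mult_pCons_left mult_pCons_right)
  qed
  from this [of n] show "t \<in> zero_set (\<Prod>i=1..n. [:- l i, 1:])"
    using P by (simp add: zero_set_def idempotent_chain_def)
qed

text \<open>
  The mirror image: the kernels form a decreasing flag, so the factors are applied from the first to
  the last.
\<close>

lemma kernel_triangular_subset_zero_set:
  assumes Q: "idempotent_chain n Q"
  shows "kernel_triangular l n Q \<subseteq> zero_set (\<Prod>i=1..n. [:- l i, 1:])"
proof
  fix t assume t: "t \<in> kernel_triangular l n Q"
  have "Q k * eval_poly (\<Prod>i=1..k. [:- l i, 1:]) t = 0" if "k \<le> n" for k
    using that
  proof (induction k)
    case 0
    then show ?case
      using Q by (simp add: idempotent_chain_def)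
  next
    case (Suc k)
    let ?e = "eval_poly (\<Prod>i=1..k. [:- l i, 1:]) t" and ?d = "t - l (Suc k) *\<^sub>C 1"
    have "Q (Suc k) * ?d = Q (Suc k) * ?d * Q k"
      using t Suc.prems by (simp add: kernel_triangular_def right_diff_distrib)
    then have "Q (Suc k) * ?d * ?e = Q (Suc k) * ?d * Q k * ?e"
      by (rule arg_cong)
    then have "Q (Suc k) * (?d * ?e) = Q (Suc k) * ?d * (Q k * ?e)"
      by (simp only: mult.assoc)
    moreover have "(\<Prod>i=1..Suc k. [:- l i, 1:]) = [:- l (Suc k), 1:] * (\<Prod>i=1..k. [:- l i, 1:])"
      by (subst mult.commute) (simp del: mult_pCons_left mult_pCons_right)
    then have "eval_poly (\<Prod>i=1..Suc k. [:- l i, 1:]) t = ?d * ?e"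
      by (simp only: eval_poly_mult eval_poly_linear)
    ultimately show ?case
      using Suc by simp
  qed
  from this [of n] show "t \<in> zero_set (\<Prod>i=1..n. [:- l i, 1:])"
    using Q by (simp add: zero_set_def idempotent_chain_def)
qed

lemma chain_sum_mult:
  assumes P: "idempotent_chain n P" and "j \<le> m" "m \<le> n"
  shows "chain_sum l P m * P j = chain_sum l P j" "P j * chain_sum l P m = chain_sum l P j"
proof -
  have "chain_sum l P m * P j = chain_sum l P j \<and> P j * chain_sum l P m = chain_sum l P j"
    using assms(2,3)
  proof (induction m rule: dec_induct)
    case base
    have "(P (Suc i) - P i) * P j = P (Suc i) - P i" "P j * (P (Suc i) - P i) = P (Suc i) - P i"
      if "i < j" for i
      using that P base by (simp_all add: idempotent_chain_def left_diff_distrib right_diff_distrib)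
    then show ?case
      by (simp add: chain_sum_def sum_distrib_left sum_distrib_right mult_scaleC_left
          mult_scaleC_right)
  next
    case (step m)
    have "(P (Suc m) - P m) * P j = 0" "P j * (P (Suc m) - P m) = 0"
      using P step by (simp_all add: idempotent_chain_def left_diff_distrib right_diff_distrib)
    then show ?case
      using step
      by (simp add: chain_sum_def mult_scaleC_left mult_scaleC_right distrib_left distrib_right)
  qed
  then show "chain_sum l P m * P j = chain_sum l P j" "P j * chain_sum l P m = chain_sum l P j"
    by auto
qed

text \<open>
  The coefficient of \<open>P (k + 1)\<close> cancels. This is why subtracting \<open>l (k + 1)\<close> lowers the level in the
  chain by one.
\<close>

lemma chain_sum_shift:
  "chain_sum l P (Suc k) - l (Suc k) *\<^sub>C P (Suc k) = chain_sum l P k - l (Suc k) *\<^sub>C P k"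
  by (simp add: chain_sum_def scaleC_diff_right)

text \<open>
  The hypotheses say that \<open>G k\<close> and \<open>P k\<close> have the same range. Triangularity depends on the flag of
  ranges only, so the diagonal element of \<open>G\<close> is triangular for \<open>P\<close>.
\<close>

lemma chain_sum_range_triangular:
  assumes G: "idempotent_chain n G"
    and GP: "\<And>k. k \<le> n \<Longrightarrow> P k * G k = G k" "\<And>k. k \<le> n \<Longrightarrow> G k * P k = P k"
  shows "chain_sum l G n \<in> range_triangular l n P"
  unfolding range_triangular_def
proof (safe)
  fix k assume k: "k < n"
  let ?b = "chain_sum l G" and ?c = "l (Suc k)"
  have "(?b n - ?c *\<^sub>C 1) * P (Suc k) = (?b n - ?c *\<^sub>C 1) * G (Suc k) * P (Suc k)"
    using GP(2) [of "Suc k"] k by (simp add: mult.assoc)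
  also have "(?b n - ?c *\<^sub>C 1) * G (Suc k) = ?b k - ?c *\<^sub>C G k"
    using chain_sum_mult [OF G, of "Suc k" n l] k chain_sum_shift [of l G k]
    by (simp add: left_diff_distrib mult_scaleC_left)
  also have "\<dots> = G k * (?b k - ?c *\<^sub>C 1)"
    using chain_sum_mult(2) [OF G, of k k l] k by (simp add: right_diff_distrib mult_scaleC_right)
  also have "\<dots> = P k * (G k * (?b k - ?c *\<^sub>C 1))"
    using GP(1) [of k] k by (simp flip: mult.assoc)
  finally have *: "(?b n - ?c *\<^sub>C 1) * P (Suc k) =
      P k * (G k * (?b k - ?c *\<^sub>C 1) * P (Suc k))"
    by (simp add: mult.assoc)
  have "P k * P k = P k"
    using GP [of k] k by (metis mult.assoc less_imp_le)
  then have "(1 - P k) * (P k * x) = 0" for x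
    by (simp add: left_diff_distrib flip: mult.assoc)
  then show "(1 - P k) * (?b n - ?c *\<^sub>C 1) * P (Suc k) = 0"
    by (simp only: mult.assoc [of "1 - P k"] *)
qed

text \<open>
  Here \<open>G k\<close> and \<open>Q k\<close> have the same kernel.
\<close>

lemma chain_sum_kernel_triangular:
  assumes G: "idempotent_chain n G"
    and GQ: "\<And>k. k \<le> n \<Longrightarrow> Q k * G k = Q k" "\<And>k. k \<le> n \<Longrightarrow> G k * Q k = G k"
  shows "chain_sum l G n \<in> kernel_triangular l n Q"
  unfolding kernel_triangular_def
proof (safe)
  fix k assume k: "k < n"
  let ?b = "chain_sum l G" and ?c = "l (Suc k)"
  have "Q (Suc k) * (?b n - ?c *\<^sub>C 1) = Q (Suc k) * (G (Suc k) * (?b n - ?c *\<^sub>C 1))"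
    using GQ(1) [of "Suc k"] k by (simp flip: mult.assoc)
  also have "G (Suc k) * (?b n - ?c *\<^sub>C 1) = ?b k - ?c *\<^sub>C G k"
    using chain_sum_mult [OF G, of "Suc k" n l] k chain_sum_shift [of l G k]
    by (simp add: right_diff_distrib mult_scaleC_right)
  also have "\<dots> = (?b k - ?c *\<^sub>C 1) * G k"
    using chain_sum_mult(1) [OF G, of k k l] k by (simp add: left_diff_distrib mult_scaleC_left)
  finally have *: "Q (Suc k) * (?b n - ?c *\<^sub>C 1) = Q (Suc k) * (?b k - ?c *\<^sub>C 1) * G k"
    by (simp add: mult.assoc)
  have "G k * (1 - Q k) = 0"
    using GQ(2) [of k] k by (simp add: right_diff_distrib)
  then show "Q (Suc k) * (?b n - ?c *\<^sub>C 1) * (1 - Q k) = 0"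
    by (simp only: * mult.assoc [of _ "G k"] mult_zero_right)
qed

section \<open>The idempotent with the range of one idempotent and the kernel of another\<close>

text \<open>
  The inverse of \<open>1 - y\<close> for \<open>norm y < 1\<close>.
\<close>

definition neumann :: "'a::{real_normed_algebra_1,banach} \<Rightarrow> 'a" where
  "neumann y = (\<Sum>m. y ^ m)"

lemma neumann_inverse:
  fixes y :: "'a::{real_normed_algebra_1,banach}"
  assumes "norm y < 1"
  shows "neumann y * (1 - y) = 1" "(1 - y) * neumann y = 1"
proof -
  have s: "summable (\<lambda>m. y ^ m)"
    using assms by (rule complete_algebra_summable_geometric)
  have "neumann y = 1 + (\<Sum>m. y ^ Suc m)"
    using suminf_split_head [OF s] by (simp add: neumann_def)
  moreover have "(\<Sum>m. y ^ Suc m) = y * neumann y"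
    using suminf_mult [OF s, of y] by (simp add: neumann_def)
  moreover have "(\<Sum>m. y ^ Suc m) = neumann y * y"
    using suminf_mult2 [OF s, of y] by (simp add: neumann_def power_commutes)
  ultimately show "neumann y * (1 - y) = 1" "(1 - y) * neumann y = 1"
    by (metis add_diff_cancel_right' mult.right_neutral mult_1 left_diff_distrib right_diff_distrib)+
qed

lemma tendsto_neumann: "(neumann \<longlongrightarrow> 1) (nhds (0 :: 'a::{real_normed_algebra_1,banach}))"
proof -
  have bound: "norm (neumann y - 1) \<le> 2 * norm y" if y: "norm y < 1/2" for y :: 'a
  proof -
    have eq: "neumann y = 1 + y * neumann y"
      using neumann_inverse(2) [of y] y by (simp add: left_diff_distrib algebra_simps)
    have yv: "norm (y * neumann y) \<le> norm y * norm (neumann y)"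
      by (rule norm_mult_ineq)
    have "norm y * norm (neumann y) \<le> 1/2 * norm (neumann y)"
      using y by (intro mult_right_mono) auto
    moreover have "norm (neumann y) \<le> 1 + norm (y * neumann y)"
      using norm_triangle_ineq [of 1 "y * neumann y"] eq by simp
    ultimately have "norm (neumann y) \<le> 2"
      using yv by simp
    then have "norm y * norm (neumann y) \<le> norm y * 2"
      by (intro mult_left_mono) auto
    moreover have "neumann y - 1 = y * neumann y"
      using eq by (simp add: diff_eq_eq add.commute)
    ultimately show ?thesis
      using yv by simp
  qed
  have "eventually (\<lambda>y::'a. norm y < 1/2) (nhds 0)"
    by (auto simp: eventually_nhds_metric intro!: exI [of _ "1/2"])
  then have "eventually (\<lambda>y::'a. norm (neumann y - 1) \<le> 2 * norm y) (nhds 0)"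
    by eventually_elim (rule bound)
  moreover have "((\<lambda>y::'a. 2 * norm y) \<longlongrightarrow> 2 * norm (0::'a)) (nhds 0)"
    by (intro tendsto_intros filterlim_ident)
  then have "((\<lambda>y::'a. 2 * norm y) \<longlongrightarrow> 0) (nhds 0)"
    by simp
  ultimately have "((\<lambda>y::'a. neumann y - 1) \<longlongrightarrow> 0) (nhds 0)"
    by (rule Lim_null_comparison)
  then show ?thesis
    by (rule LIM_zero_cancel)
qed

text \<open>
  The element \<open>1 - (P - Q)\<^sup>2\<close> commutes with both idempotents and equals \<open>P * Q * P\<close> on the range of \<open>P\<close>.
  Dividing \<open>P * Q\<close>, which maps into the range of \<open>P\<close> and kills the kernel of \<open>Q\<close>, by it gives an
  idempotent that is explicitly continuous in \<open>P\<close> and \<open>Q\<close>.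
\<close>

definition range_kernel_idempotent :: "'a \<Rightarrow> 'a \<Rightarrow> 'a::{real_normed_algebra_1,banach}" where
  "range_kernel_idempotent P Q = neumann ((P - Q)\<^sup>2) * P * Q"

text \<open>
  The first two equations say that the ranges of \<open>P\<close> and of the new idempotent coincide, the last two
  that the kernels of \<open>Q\<close> and of the new idempotent coincide.
\<close>

lemma range_kernel_idempotent:
  fixes P Q :: "'a::{real_normed_algebra_1,banach}"
  assumes P: "P * P = P" and Q: "Q * Q = Q" and small: "norm ((P - Q)\<^sup>2) < 1"
  shows "P * range_kernel_idempotent P Q = range_kernel_idempotent P Q"
    and "range_kernel_idempotent P Q * P = P"
    and "Q * range_kernel_idempotent P Q = Q"
    and "range_kernel_idempotent P Q * Q = range_kernel_idempotent P Q"
proof -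
  define u where "u = 1 - (P - Q)\<^sup>2"
  define v where "v = neumann ((P - Q)\<^sup>2)"
  have vu: "v * u = 1" and uv: "u * v = 1"
    using neumann_inverse [OF small] by (simp_all add: u_def v_def)
  have u: "u = 1 - P - Q + P * Q + Q * P"
    by (simp add: u_def power2_eq_square algebra_simps P Q)
  have PP: "P * (P * x) = P * x" and QQ: "Q * (Q * x) = Q * x" for x
    by (simp_all add: P Q flip: mult.assoc)
  have uP: "u * P = P * Q * P" "P * u = P * Q * P" and uQ: "u * Q = Q * P * Q" "Q * u = Q * P * Q"
    by (simp_all add: u algebra_simps P Q PP QQ)
  \<comment> \<open>Whatever commutes with \<open>u\<close> commutes with its inverse.\<close>
  have comm: "x * v = v * x" if "u * x = x * u" for x
  proof -
    have "v * (x * u) * v = v * (u * x) * v"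
      using that by simp
    then show ?thesis
      by (metis mult.assoc mult.left_neutral mult.right_neutral uv vu)
  qed
  have vP: "P * v = v * P" and vQ: "Q * v = v * Q"
    by (simp_all add: comm uP uQ)
  have G: "range_kernel_idempotent P Q = v * P * Q"
    by (simp add: range_kernel_idempotent_def v_def)
  show "P * range_kernel_idempotent P Q = range_kernel_idempotent P Q"
    by (metis G vP P mult.assoc)
  show "range_kernel_idempotent P Q * Q = range_kernel_idempotent P Q"
    by (metis G Q mult.assoc)
  show "range_kernel_idempotent P Q * P = P"
    by (metis G uP(1) vu mult.assoc mult_1)
  show "Q * range_kernel_idempotent P Q = Q"
    by (metis G vQ uQ(1) vu mult.assoc mult_1)
qed

lemma tendsto_range_kernel_idempotent:
  fixes P Q :: "'b \<Rightarrow> 'a::{real_normed_algebra_1,banach}"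
  assumes "(P \<longlongrightarrow> e) F" "(Q \<longlongrightarrow> e) F" "e * e = e"
  shows "((\<lambda>w. range_kernel_idempotent (P w) (Q w)) \<longlongrightarrow> e) F"
proof -
  have "((\<lambda>w. (P w - Q w)\<^sup>2) \<longlongrightarrow> (e - e)\<^sup>2) F"
    by (intro tendsto_intros assms)
  then have "((\<lambda>w. neumann ((P w - Q w)\<^sup>2)) \<longlongrightarrow> 1) F"
    by (intro filterlim_compose [OF tendsto_neumann]) simp
  then have "((\<lambda>w. range_kernel_idempotent (P w) (Q w)) \<longlongrightarrow> 1 * e * e) F"
    unfolding range_kernel_idempotent_def by (intro tendsto_intros assms)
  then show ?thesis
    using assms(3) by simp
qed

text \<open>
  Nested ranges come from the chain \<open>P\<close>, nested kernels from the chain \<open>Q\<close>.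
\<close>

lemma idempotent_chain_range_kernel:
  fixes P Q :: "nat \<Rightarrow> 'a::{real_normed_algebra_1,banach}"
  assumes P: "idempotent_chain n P" and Q: "idempotent_chain n Q"
    and small: "\<And>k. k \<le> n \<Longrightarrow> norm ((P k - Q k)\<^sup>2) < 1"
  shows "idempotent_chain n (\<lambda>k. range_kernel_idempotent (P k) (Q k))"
proof -
  define G where "G k = range_kernel_idempotent (P k) (Q k)" for k
  note PQ = P [unfolded idempotent_chain_def] Q [unfolded idempotent_chain_def]
  have G: "P k * G k = G k" "G k * P k = P k" "Q k * G k = Q k" "G k * Q k = G k" if "k \<le> n" for k
    unfolding G_def using that PQ small by (auto intro!: range_kernel_idempotent)
  have "G 0 = 0"
    using G(1) [of 0] PQ by simp
  moreover have "G n = 1"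
    using G(2) [of n] PQ by simp
  moreover have "G j * G k = G j" "G k * G j = G j" if "j \<le> k" "k \<le> n" for j k
  proof -
    have "G j * G k = G j * (Q j * Q k) * G k"
      using G(4) [of j] PQ that by (metis order.trans mult.assoc)
    also have "\<dots> = G j * Q j * (Q k * G k)"
      by (simp add: mult.assoc)
    also have "\<dots> = G j"
      using G(3) [of k] G(4) [of j] PQ that by (metis order.trans mult.assoc)
    finally show "G j * G k = G j" .
    have "G k * G j = G k * (P k * P j) * G j"
      using G(1) [of j] PQ that by (metis order.trans mult.assoc)
    also have "\<dots> = G k * P k * (P j * G j)"
      by (simp add: mult.assoc)
    also have "\<dots> = G j"
      using G(2) [of k] G(1) [of j] PQ that by (metis order.trans mult.assoc)
    finally show "G k * G j = G j" .
  qed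
  ultimately show ?thesis
    by (simp add: idempotent_chain_def G_def)
qed

section \<open>Joining nearby points\<close>

text \<open>
  Evaluated at a zero of \<open>p\<close>, this interpolating polynomial gives the spectral idempotent of the
  eigenvalues \<open>l 1, ..., l k\<close>; in this form it depends continuously on the zero.
\<close>

definition spectral_step :: "nat \<Rightarrow> (nat \<Rightarrow> complex) \<Rightarrow> nat \<Rightarrow> complex poly" where
  "spectral_step n l k = (SOME q. \<forall>i\<in>{1..n}. poly q (l i) = (if i \<le> k then 1 else 0))"

lemma poly_spectral_step:
  assumes "inj_on l {1..n}" "i \<in> {1..n}"
  shows "poly (spectral_step n l k) (l i) = (if i \<le> k then 1 else 0)"
proof -
  have "\<exists>q. \<forall>i\<in>{1..n}. poly q (l i) = (if i \<le> k then 1 else 0)"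
    using assms(1) by (intro lagrange_interpolation) auto
  from someI_ex [OF this] show ?thesis
    using assms(2) unfolding spectral_step_def by blast
qed

lemma idempotent_chain_spectral_step:
  assumes l: "inj_on l {1..n}" and a: "a \<in> zero_set (\<Prod>i=1..n. [:- l i, 1:])"
  shows "idempotent_chain n (\<lambda>k. eval_poly (spectral_step n l k) a)"
proof -
  note eq = eval_poly_eqI [OF l a] and val = poly_spectral_step [OF l]
  have "eval_poly (spectral_step n l 0) a = eval_poly 0 a"
    by (rule eq) (simp add: val)
  moreover have "eval_poly (spectral_step n l n) a = eval_poly 1 a"
    by (rule eq) (simp add: val)
  moreover have "eval_poly (spectral_step n l j * spectral_step n l k) a
        = eval_poly (spectral_step n l j) a"
      "eval_poly (spectral_step n l k * spectral_step n l j) a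
        = eval_poly (spectral_step n l j) a" if "j \<le> k" for j k
    using that by (auto intro!: eq simp: val)
  ultimately show ?thesis
    by (simp add: idempotent_chain_def eval_poly_mult)
qed

text \<open>
  The spectral decomposition of a zero of \<open>p\<close>, read off from the interpolation of the identity function at
  the nodes.
\<close>

lemma chain_sum_spectral_step:
  assumes l: "inj_on l {1..n}" and a: "a \<in> zero_set (\<Prod>i=1..n. [:- l i, 1:])"
  shows "chain_sum l (\<lambda>k. eval_poly (spectral_step n l k) a) n = a"
proof -
  define r where "r = (\<Sum>i<n. smult (l (Suc i))
    (spectral_step n l (Suc i) + smult (-1) (spectral_step n l i)))"
  have neg: "(-1) *\<^sub>C x = - x" for x :: 'a
    using scaleC_of_real [of "-1" x] by simp
  have "chain_sum l (\<lambda>k. eval_poly (spectral_step n l k) a) n = eval_poly r a"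
    by (simp add: chain_sum_def r_def eval_poly_sum eval_poly_smult eval_poly_add neg
        del: smult_minus_left)
  also have "\<dots> = eval_poly [:0, 1:] a"
  proof (rule eval_poly_eqI [OF l a])
    fix i assume i: "i \<in> {1..n}"
    have "poly r (l i) = (\<Sum>j<n. if j = i - 1 then l (Suc j) else 0)"
      unfolding r_def poly_sum
      by (intro sum.cong) (use i in \<open>auto simp: poly_spectral_step [OF l]\<close>)
    also have "\<dots> = l i"
      using i by (subst sum.delta) auto
    finally show "poly r (l i) = poly [:0, 1:] (l i)"
      by simp
  qed
  also have "\<dots> = a"
    using eval_poly_linear [of 0 a] by simp
  finally show ?thesis .
qed

lemma polygonally_joined_two_segments:
  assumes "n \<ge> 2" "closed_segment y b \<subseteq> S" "closed_segment b z \<subseteq> S"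
  shows "polygonally_joined n S y z"
  unfolding polygonally_joined_def
proof (intro exI conjI allI impI)
  let ?x = "\<lambda>i::nat. if i = 0 then y else if i = 1 then b else z"
  show "?x 0 = y" "?x n = z"
    using assms(1) by auto
  have "z \<in> S"
    using assms(3) by auto
  then show "closed_segment (?x i) (?x (Suc i)) \<subseteq> S" for i
    using assms by auto
qed

text \<open>
  The bridge is the zero of \<open>p\<close> with the range flag of \<open>y\<close> and the kernel flag of \<open>z\<close>. Its continuity in
  both arguments at \<open>(x, x)\<close>, where its value is \<open>x\<close>, provides the radius.
\<close>

lemma nearby_zeros_polygonally_joined:
  fixes x :: "'a::complex_banach_algebra_1"
  assumes "n \<ge> 2" and l: "inj_on l {1..n}" and p: "p = (\<Prod>i=1..n. [:- l i, 1:])"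
    and x: "x \<in> zero_set p" and "\<epsilon> > 0"
  shows "\<exists>\<delta>>0. \<forall>y\<in>zero_set p \<inter> ball x \<delta>. \<forall>z\<in>zero_set p \<inter> ball x \<delta>.
    polygonally_joined n (zero_set p \<inter> ball x \<epsilon>) y z"
proof -
  define P where "P a k = eval_poly (spectral_step n l k) a" for a :: 'a and k
  define bridge where
    "bridge y z = chain_sum l (\<lambda>k. range_kernel_idempotent (P y k) (P z k)) n" for y z
  define F where "F = nhds x \<times>\<^sub>F nhds x"
  have chain: "idempotent_chain n (P a)" and sum: "chain_sum l (P a) n = a"
    if "a \<in> zero_set p" for a
    using that idempotent_chain_spectral_step [OF l] chain_sum_spectral_step [OF l]
    by (simp_all add: P_def [abs_def] p)
  have fst: "(fst \<longlongrightarrow> x) F" and snd: "(snd \<longlongrightarrow> x) F"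
    unfolding F_def by (rule filterlim_fst filterlim_snd)+
  have Pfst: "((\<lambda>w. P (fst w) k) \<longlongrightarrow> P x k) F" and Psnd: "((\<lambda>w. P (snd w) k) \<longlongrightarrow> P x k) F" for k
    unfolding P_def by (intro tendsto_eval_poly fst snd)+
  have "((\<lambda>w. (P (fst w) k - P (snd w) k)\<^sup>2) \<longlongrightarrow> (P x k - P x k)\<^sup>2) F" for k
    by (intro tendsto_intros Pfst Psnd)
  then have "((\<lambda>w. norm ((P (fst w) k - P (snd w) k)\<^sup>2)) \<longlongrightarrow> 0) F" for k
    using tendsto_norm_zero by fastforce
  then have "\<forall>\<^sub>F w in F. norm ((P (fst w) k - P (snd w) k)\<^sup>2) < 1" for k
    by (rule order_tendstoD) simp
  then have small: "\<forall>\<^sub>F w in F. \<forall>k\<in>{..n}. norm ((P (fst w) k - P (snd w) k)\<^sup>2) < 1"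
    by (intro eventually_ball_finite) auto
  have "((\<lambda>w. range_kernel_idempotent (P (fst w) k) (P (snd w) k)) \<longlongrightarrow> P x k) F" if "k \<le> n" for k
    using chain [OF x] that
    by (intro tendsto_range_kernel_idempotent Pfst Psnd) (simp add: idempotent_chain_def)
  then have "((\<lambda>w. bridge (fst w) (snd w)) \<longlongrightarrow> chain_sum l (P x) n) F"
    unfolding bridge_def chain_sum_def by (intro tendsto_intros tendsto_scaleC) auto
  \<comment> \<open>The limit is the spectral decomposition of \<open>x\<close>, that is, \<open>x\<close> itself.\<close>
  then have "\<forall>\<^sub>F w in F. bridge (fst w) (snd w) \<in> ball x \<epsilon>"
    using sum [OF x] \<open>\<epsilon> > 0\<close> by (simp add: tendsto_iff dist_commute)
  with small have "\<forall>\<^sub>F w in F. bridge (fst w) (snd w) \<in> ball x \<epsilon> \<and>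
      (\<forall>k\<in>{..n}. norm ((P (fst w) k - P (snd w) k)\<^sup>2) < 1)"
    by eventually_elim simp
  then obtain A where A: "eventually A (nhds x)"
    "\<And>y z. A y \<Longrightarrow> A z \<Longrightarrow> bridge y z \<in> ball x \<epsilon> \<and> (\<forall>k\<in>{..n}. norm ((P y k - P z k)\<^sup>2) < 1)"
    unfolding F_def eventually_prod_same by auto
  then obtain d where d: "d > 0" "\<And>y. dist y x < d \<Longrightarrow> A y"
    unfolding eventually_nhds_metric by blast
  have "polygonally_joined n (zero_set p \<inter> ball x \<epsilon>) y z"
    if y: "y \<in> zero_set p" "dist x y < min d \<epsilon>" and z: "z \<in> zero_set p" "dist x z < min d \<epsilon>" for y z
  proof -
    define G where "G k = range_kernel_idempotent (P y k) (P z k)" for k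
    have b: "bridge y z = chain_sum l G n"
      by (simp add: bridge_def G_def [abs_def])
    have near: "bridge y z \<in> ball x \<epsilon>" and sm: "k \<le> n \<Longrightarrow> norm ((P y k - P z k)\<^sup>2) < 1" for k
      using A(2) [of y z] d(2) y z by (auto simp: dist_commute)
    note Py = chain [OF y(1)] and Pz = chain [OF z(1)]
    have G: "idempotent_chain n G"
      unfolding G_def using Py Pz sm by (rule idempotent_chain_range_kernel)
    have idem: "P y k * P y k = P y k" "P z k * P z k = P z k" if "k \<le> n" for k
      using Py Pz that by (simp_all add: idempotent_chain_def)
    have rk: "P y k * G k = G k" "G k * P y k = P y k" "P z k * G k = P z k" "G k * P z k = G k"
      if "k \<le> n" for k
      unfolding G_def using idem sm that by (auto intro!: range_kernel_idempotent)
    have "y \<in> range_triangular l n (P y)"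
      using chain_sum_range_triangular [OF Py, of "P y" l] idem sum [OF y(1)] by simp
    moreover have "bridge y z \<in> range_triangular l n (P y)"
      unfolding b using G rk by (intro chain_sum_range_triangular)
    ultimately have "closed_segment y (bridge y z) \<subseteq> zero_set p"
      using range_triangular_subset_zero_set [OF Py] p
      by (metis closed_segment_subset convex_range_triangular order.trans)
    moreover have "bridge y z \<in> kernel_triangular l n (P z)"
      unfolding b using G rk by (intro chain_sum_kernel_triangular)
    moreover have "z \<in> kernel_triangular l n (P z)"
      using chain_sum_kernel_triangular [OF Pz, of "P z" l] idem sum [OF z(1)] by simp
    ultimately have seg: "closed_segment y (bridge y z) \<subseteq> zero_set p"
        "closed_segment (bridge y z) z \<subseteq> zero_set p"
      using kernel_triangular_subset_zero_set [OF Pz] p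
      by (metis closed_segment_subset convex_kernel_triangular order.trans)+
    have "closed_segment y (bridge y z) \<subseteq> ball x \<epsilon>" "closed_segment (bridge y z) z \<subseteq> ball x \<epsilon>"
      using near y z by (intro closed_segment_subset; simp)+
    with seg show ?thesis
      by (intro polygonally_joined_two_segments [OF \<open>n \<ge> 2\<close>, of _ "bridge y z"]) auto
  qed
  then show ?thesis
    using d(1) \<open>\<epsilon> > 0\<close> by (intro exI [of _ "min d \<epsilon>"]) auto
qed

section \<open>Local connectedness of the component\<close>

text \<open>
  A path in \<open>S\<close> that starts in a connected component of \<open>S\<close> stays in that component.
\<close>

lemma polygonally_joined_component:
  assumes join: "polygonally_joined n (S \<inter> B) y z" and y: "y \<in> connected_component_set S a"
  shows "polygonally_joined n (connected_component_set S a \<inter> B) y z"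
proof -
  obtain x where x: "x 0 = y" "x n = z"
    and seg: "\<And>i. i < n \<Longrightarrow> closed_segment (x i) (x (Suc i)) \<subseteq> S \<inter> B"
    using join unfolding polygonally_joined_def by auto
  have sub: "closed_segment (x i) (x (Suc i)) \<subseteq> connected_component_set S a"
    if "i < n" "x i \<in> connected_component_set S a" for i
  proof -
    have "closed_segment (x i) (x (Suc i)) \<subseteq> connected_component_set S (x i)"
      using seg [OF that(1)] by (intro connected_component_maximal) auto
    then show ?thesis
      using connected_component_eq that(2) by blast
  qed
  have "x i \<in> connected_component_set S a" if "i \<le> n" for i
    using that
  proof (induction i)
    case (Suc i)
    then show ?case
      using sub [of i] by auto
  qed (use x y in simp)
  then have "\<forall>i<n. closed_segment (x i) (x (Suc i)) \<subseteq> connected_component_set S a \<inter> B"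
    using sub seg by (metis Int_subset_iff less_imp_le)
  then show ?thesis
    unfolding polygonally_joined_def using x by blast
qed

lemma polygonally_joined_mono:
  assumes "polygonally_joined n S y z" "S \<subseteq> T"
  shows "polygonally_joined n T y z"
proof -
  obtain x where x: "x 0 = y" "x n = z" "\<forall>i<n. closed_segment (x i) (x (Suc i)) \<subseteq> S"
    using assms(1) unfolding polygonally_joined_def by auto
  then have "\<forall>i<n. closed_segment (x i) (x (Suc i)) \<subseteq> T"
    using assms(2) by (meson subset_trans)
  with x show ?thesis
    unfolding polygonally_joined_def by (intro exI [of _ x]) simp
qed

lemma polygonally_joined_imp_path_component:
  assumes "polygonally_joined n S y z" "y \<in> S"
  shows "path_component S y z"
proof -
  obtain x where x: "x 0 = y" "x n = z"
    and seg: "\<And>i. i < n \<Longrightarrow> closed_segment (x i) (x (Suc i)) \<subseteq> S"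
    using assms(1) unfolding polygonally_joined_def by auto
  have "path_component S y (x i)" if "i \<le> n" for i
    using that
  proof (induction i)
    case (Suc i)
    have "path_component S (x i) (x (Suc i))"
      unfolding path_component_def using seg [of i] Suc.prems
      by (intro exI [of _ "linepath (x i) (x (Suc i))"]) auto
    then show ?case
      using Suc path_component_trans by fastforce
  qed (use x assms(2) in \<open>simp add: path_component_refl\<close>)
  then show ?thesis
    using x by blast
qed

lemma locally_polygonally_connected_imp_locally_path_connected:
  assumes "locally_polygonally_connected n S"
  shows "locally path_connected S"
proof -
  have "\<exists>V. openin (top_of_set S) V \<and> x \<in> V \<and> V \<subseteq> U \<and>
      (\<forall>y. y \<in> V \<longrightarrow> (\<exists>g. path g \<and> path_image g \<subseteq> U \<and> pathstart g = x \<and> pathfinish g = y))"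
    if "openin (top_of_set S) U" "x \<in> U" for U x
  proof -
    have "\<exists>V. openin (top_of_set S) V \<and> x \<in> V \<and> V \<subseteq> U \<and>
        (\<forall>y\<in>V. \<forall>z\<in>V. polygonally_joined n U y z)"
      using assms that unfolding locally_polygonally_connected_def by simp
    then obtain V where V: "openin (top_of_set S) V" "x \<in> V" "V \<subseteq> U"
      "\<forall>y\<in>V. \<forall>z\<in>V. polygonally_joined n U y z"
      by (elim exE conjE)
    have "path_component U x y" if "y \<in> V" for y
      using V(2,4) that \<open>x \<in> U\<close> polygonally_joined_imp_path_component by metis
    then show ?thesis
      unfolding path_component_def using V(1-3) by (intro exI [of _ V]) simp
  qed
  then show ?thesis
    unfolding locally_path_connected_im_kleinen by blast
qed

theorem theorem15:
  fixes n :: nat and l :: "nat \<Rightarrow> complex" and p :: "complex poly"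
    and a\<^sub>0 :: "'a::complex_banach_algebra_1"
  assumes "n \<ge> 2"
    and "inj_on l {1..n}"
    and "p = (\<Prod>i=1..n. [:- l i, 1:])"
    and "a\<^sub>0 \<in> zero_set p"
  shows "(\<forall>\<epsilon>>0. \<exists>\<delta>>0. \<forall>a\<^sub>1\<in>zero_set p. norm (a\<^sub>1 - a\<^sub>0) < \<delta> \<longrightarrow>
            polygonally_joined n (zero_set p \<inter> ball a\<^sub>0 \<epsilon>) a\<^sub>0 a\<^sub>1)
       \<and> locally path_connected (connected_component_set (zero_set p) a\<^sub>0)
       \<and> locally_polygonally_connected n (connected_component_set (zero_set p) a\<^sub>0)"
proof -
  note near = nearby_zeros_polygonally_joined [OF assms(1-3)]
  let ?C = "connected_component_set (zero_set p) a\<^sub>0"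
  have joined: "\<exists>\<delta>>0. \<forall>a\<^sub>1\<in>zero_set p. norm (a\<^sub>1 - a\<^sub>0) < \<delta> \<longrightarrow>
      polygonally_joined n (zero_set p \<inter> ball a\<^sub>0 \<epsilon>) a\<^sub>0 a\<^sub>1" if "\<epsilon> > 0" for \<epsilon>
  proof -
    obtain \<delta> where "\<delta> > 0" "\<forall>y\<in>zero_set p \<inter> ball a\<^sub>0 \<delta>. \<forall>z\<in>zero_set p \<inter> ball a\<^sub>0 \<delta>.
        polygonally_joined n (zero_set p \<inter> ball a\<^sub>0 \<epsilon>) y z"
      using near [OF assms(4) \<open>\<epsilon> > 0\<close>] by blast
    then show ?thesis
      using assms(4) by (intro exI [of _ \<delta>]) (simp add: dist_norm norm_minus_commute)
  qed
  have local: "locally_polygonally_connected n ?C"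
    unfolding locally_polygonally_connected_def
  proof (intro allI impI, elim conjE)
    fix U x assume U: "openin (top_of_set ?C) U" "x \<in> U"
    then obtain \<epsilon> where \<epsilon>: "\<epsilon> > 0" "ball x \<epsilon> \<inter> ?C \<subseteq> U"
      unfolding openin_contains_ball by blast
    have xC: "x \<in> ?C"
      using U openin_imp_subset by blast
    then have "x \<in> zero_set p"
      using connected_component_subset by blast
    then obtain \<delta> where \<delta>: "\<delta> > 0"
        "\<And>y z. y \<in> zero_set p \<inter> ball x \<delta> \<Longrightarrow> z \<in> zero_set p \<inter> ball x \<delta> \<Longrightarrow>
          polygonally_joined n (zero_set p \<inter> ball x \<epsilon>) y z"
      using near [OF _ \<epsilon>(1)] by metis
    let ?V = "U \<inter> ball x \<delta>"
    have "openin (top_of_set ?C) ?V"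
      using U(1) by (rule openin_Int_open) simp
    moreover have "polygonally_joined n U y z" if "y \<in> ?V" "z \<in> ?V" for y z
    proof -
      have "y \<in> ?C" "z \<in> ?C"
        using that U(1) openin_imp_subset by blast+
      moreover from this have "y \<in> zero_set p" "z \<in> zero_set p"
        using connected_component_subset by blast+
      ultimately have "polygonally_joined n (?C \<inter> ball x \<epsilon>) y z"
        using \<delta>(2) that by (intro polygonally_joined_component) auto
      then show ?thesis
        using \<epsilon>(2) by (blast intro: polygonally_joined_mono)
    qed
    ultimately show "\<exists>V. openin (top_of_set ?C) V \<and> x \<in> V \<and> V \<subseteq> U \<and>
        (\<forall>y\<in>V. \<forall>z\<in>V. polygonally_joined n U y z)"
      using U(2) \<delta>(1) by (intro exI [of _ ?V]) auto
  qed
  from joined local locally_polygonally_connected_imp_locally_path_connected [OF local]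
  show ?thesis
    by blast
qed

end
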